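(* Let $V$ be a valuation domain with algebraically closed residue field and whose maximal ideal $\mathfrak{m}$ is not principal. Suppose that the value group $\Gamma$ of $V$ is not divisible. Then for any nonzero $t\in\mathfrak{m}$, the finitely generated ideal $(x^2,t^2)$ of $\operatorname{Int}^{R}(V)$ is not Skolem closed; in particular $\operatorname{Int}^{R}(V)$ does not have the strong Skolem property.
   Context: Let $K$ be the field of fractions of $V$. $\operatorname{Int}^{R}(V)=\{\varphi\in K(x)\mid\varphi(a)\in V\text{ for all }a\in V\}$. For an ideal $I$ of $\operatorname{Int}^{R}(V)$ and $a\in V$, $I(a)=\{\varphi(a)\mid\varphi\in I\}$. The Skolem closure of $I$ is $I^{\mathrm{Sk}}=\{\varphi\in\operatorname{Int}^{R}(V)\mid\varphi(a)\in I(a)\text{ for all }a\in V\}$, and $I$ is Skolem closed if $I=I^{\mathrm{Sk}}$. $\operatorname{Int}^{R}(V)$ has the strong Skolem property if whenever $I,J$ are finitely generated ideals of $\operatorname{Int}^{R}(V)$ with $I(a)=J(a)$ for all $a\in V$, then $I=J$ (equivalently, every finitely generated ideal is Skolem closed). *)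

theory Defs
  imports "HOL-Algebra.Algebraic_Closure_Type" "HOL-Computational_Algebra.Fraction_Field"
begin

text \<open>
  A valuation domain is given as a subset \<open>V\<close> of its field of fractions, the type \<open>'k\<close>.
  Subrings are handled as \<open>HOL-Algebra\<close> rings with the operations of the ambient type.
\<close>

definition ring_on :: "'a::comm_ring_1 set \<Rightarrow> 'a ring"
  where "ring_on S = ring_of_type_algebra\<lparr>carrier := S\<rparr>"

definition valuation_domain :: "'k::field set \<Rightarrow> bool"
  where "valuation_domain V \<longleftrightarrow>
    subring V (ring_of_type_algebra :: 'k ring) \<and> (\<forall>x. x \<noteq> 0 \<longrightarrow> x \<in> V \<or> inverse x \<in> V)"

lemma valuation_domain_fraction_field:
  fixes V :: "'k::field set"
  assumes "valuation_domain V"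
  shows "\<exists>a\<in>V. \<exists>b\<in>V. b \<noteq> 0 \<and> z = a / b"
proof -
  interpret subring V "ring_of_type_algebra :: 'k ring"
    using assms by (simp add: valuation_domain_def)
  have one: "1 \<in> V" and zero: "0 \<in> V"
    using one_closed subgroup.one_closed[OF subgroup_axioms]
    by (simp_all add: ring_of_type_algebra_def)
  show ?thesis
  proof (cases "z = 0 \<or> z \<in> V")
    case True
    then show ?thesis
      using one zero by (intro bexI[of _ z] bexI[of _ 1]) auto
  next
    case False
    then have "inverse z \<in> V" "inverse z \<noteq> 0" "z = 1 / inverse z"
      using assms unfolding valuation_domain_def by (auto simp: field_simps)
    then show ?thesis using one by (intro bexI[of _ 1] bexI[of _ "inverse z"]) simp_all
  qed
qed

text \<open>The value group of the valuation of \<open>V\<close> is the group of nonzero elements of the field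
  modulo the units of \<open>V\<close>, written multiplicatively.\<close>

definition value_group :: "'k::field set \<Rightarrow> 'k set monoid"
  where "value_group V =
    mult_of (ring_of_type_algebra :: 'k ring) Mod Units (ring_on V)"

definition divisible_group :: "('a, 'b) monoid_scheme \<Rightarrow> bool"
  where "divisible_group G \<longleftrightarrow>
    (\<forall>g \<in> carrier G. \<forall>n::nat. n > 0 \<longrightarrow> (\<exists>h \<in> carrier G. h [^]\<^bsub>G\<^esub> n = g))"

text \<open>\<open>'k poly fract\<close> is the field of rational functions. A rational function has a value at
  \<open>a\<close> if some representing fraction has a denominator that does not vanish at \<open>a\<close>.\<close>

definition rat_defined_at :: "'k::field poly fract \<Rightarrow> 'k \<Rightarrow> bool"
  where "rat_defined_at \<phi> a \<longleftrightarrow> (\<exists>p q. \<phi> = Fract p q \<and> poly q a \<noteq> 0)"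

definition rat_eval :: "'k::field poly fract \<Rightarrow> 'k \<Rightarrow> 'k"
  where "rat_eval \<phi> a =
    (THE c. \<exists>p q. \<phi> = Fract p q \<and> poly q a \<noteq> 0 \<and> c = poly p a / poly q a)"

lemma rat_eval_Fract:
  assumes "poly q a \<noteq> 0"
  shows "rat_eval (Fract p q) a = poly p a / poly q a"
  unfolding rat_eval_def
proof (rule the_equality)
  show "\<exists>p' q'. Fract p q = Fract p' q' \<and> poly q' a \<noteq> 0 \<and>
      poly p a / poly q a = poly p' a / poly q' a"
    using assms by blast
next
  fix c
  assume "\<exists>p' q'. Fract p q = Fract p' q' \<and> poly q' a \<noteq> 0 \<and> c = poly p' a / poly q' a"
  then obtain p' q' where h: "Fract p q = Fract p' q'" "poly q' a \<noteq> 0" "c = poly p' a / poly q' a"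
    by blast
  have "q \<noteq> 0" "q' \<noteq> 0" using assms h(2) by auto
  then have "p * q' = p' * q" using h(1) by (simp add: eq_fract)
  then have "poly p a * poly q' a = poly p' a * poly q a" by (metis poly_mult)
  then show "c = poly p a / poly q a"
    using assms h(2,3) by (simp add: frac_eq_eq)
qed

definition rat_const :: "'k::field \<Rightarrow> 'k poly fract"
  where "rat_const c = Fract [:c:] 1"

definition rat_X :: "'k::field poly fract"
  where "rat_X = Fract [:0, 1:] 1"

definition Int_R :: "'k::field set \<Rightarrow> 'k poly fract set"
  where "Int_R V = {\<phi>. \<forall>a\<in>V. rat_defined_at \<phi> a \<and> rat_eval \<phi> a \<in> V}"

abbreviation Int_R_ring :: "'k::field set \<Rightarrow> 'k poly fract ring"
  where "Int_R_ring V \<equiv> ring_on (Int_R V)"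

definition value_ideal :: "'k::field poly fract set \<Rightarrow> 'k \<Rightarrow> 'k set"
  where "value_ideal I a = (\<lambda>\<phi>. rat_eval \<phi> a) ` I"

definition skolem_closure :: "'k::field set \<Rightarrow> 'k poly fract set \<Rightarrow> 'k poly fract set"
  where "skolem_closure V I = {\<phi> \<in> Int_R V. \<forall>a\<in>V. rat_eval \<phi> a \<in> value_ideal I a}"

definition skolem_closed :: "'k::field set \<Rightarrow> 'k poly fract set \<Rightarrow> bool"
  where "skolem_closed V I \<longleftrightarrow> I = skolem_closure V I"

definition fin_gen_ideal :: "'a set \<Rightarrow> ('a, 'b) ring_scheme \<Rightarrow> bool"
  where "fin_gen_ideal I R \<longleftrightarrow> (\<exists>S \<subseteq> carrier R. finite S \<and> I = Idl\<^bsub>R\<^esub> S)"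

definition strong_skolem_property :: "'k::field set \<Rightarrow> bool"
  where "strong_skolem_property V \<longleftrightarrow>
    (\<forall>I J. fin_gen_ideal I (Int_R_ring V) \<longrightarrow> fin_gen_ideal J (Int_R_ring V) \<longrightarrow>
      (\<forall>a\<in>V. value_ideal I a = value_ideal J a) \<longrightarrow> I = J)"

end

theory Submission
  imports Defs
begin

text \<open>
  Let \<open>I = (x\<^sup>2, t\<^sup>2)\<close>. For \<open>a \<in> V\<close> one of \<open>a\<close> and \<open>t\<close> divides the other, so that \<open>a t\<close> lies in
  \<open>I(a) = a\<^sup>2 V + t\<^sup>2 V\<close>. Thus \<open>x t\<close> belongs to the Skolem closure of \<open>I\<close>, and adjoining \<open>x t\<close> to \<open>I\<close>
  does not change the value ideals. Both claims follow once it is known that \<open>x t\<close> is not in \<open>I\<close>.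

  Suppose that \<open>x t = x\<^sup>2 \<phi> + t\<^sup>2 \<psi>\<close> with integer-valued \<open>\<phi>\<close> and \<open>\<psi>\<close>. Putting \<open>x = t y\<close> gives
  \<open>y = y\<^sup>2 f(y) + g(y)\<close>, where \<open>f(y), g(y) \<in> V\<close> whenever \<open>t y \<in> V\<close>. The reduction of \<open>f\<close> modulo the
  maximal ideal is a rational function over the residue field, and it is constrained in two ways.

  It is a polynomial \<open>C\<close> (lemma \<open>quotient_integral_imp_dvd\<close>). For if it had a pole at the residue class
  of \<open>a \<in> V\<close>, then \<open>f\<close> would not be integral at points \<open>y\<close> for which \<open>y - a\<close> has a small positive value;
  arbitrarily small values exist because the maximal ideal is not principal. A rational function without
  poles over an algebraically closed field is a polynomial.

  It vanishes at infinity to first order: for \<open>z\<close> of small positive value, \<open>y = 1 / z\<close> is still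
  admissible, and there \<open>f(y) = z (1 - z g(y))\<close> has the value of \<open>z\<close>. But a nonzero polynomial has no
  zero at infinity, and if \<open>C = 0\<close> then \<open>f(1 / z)\<close> is divisible, up to a bounded power of \<open>z\<close>, by a
  fixed element of the maximal ideal, and hence too small (lemma \<open>no_integral_solution_primitive\<close>).

  The reduction of \<open>f\<close> is handled through numerators and denominators: \<open>f = P / Q\<close> with coefficients in
  \<open>V\<close> and \<open>Q\<close> nonzero modulo the maximal ideal.
\<close>

section \<open>Valuation rings and their maximal ideal\<close>

definition coeffs_in :: "'a::zero set \<Rightarrow> 'a poly \<Rightarrow> bool"
  where "coeffs_in S p \<longleftrightarrow> (\<forall>i. coeff p i \<in> S)"

text \<open>A ring satisfying the first four conditions is a valuation ring with fraction field \<open>'k\<close>, and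
  \<open>M\<close> is forced to be its maximal ideal. Instead of valuations, quotients are used:
  for \<open>y \<noteq> 0\<close>, \<open>x / y \<in> V\<close> says that the value of \<open>x\<close> is at least that of \<open>y\<close>, and
  \<open>x / y \<in> M\<close> that it is larger.\<close>

locale valuation_ring =
  fixes V M :: "'k::field set"
  assumes one_V: "1 \<in> V"
    and diff_V: "\<And>x y. x \<in> V \<Longrightarrow> y \<in> V \<Longrightarrow> x - y \<in> V"
    and mult_V: "\<And>x y. x \<in> V \<Longrightarrow> y \<in> V \<Longrightarrow> x * y \<in> V"
    and inverse_V: "\<And>x. x \<noteq> 0 \<Longrightarrow> x \<notin> V \<Longrightarrow> inverse x \<in> V"
    and M_iff: "\<And>x. x \<in> M \<longleftrightarrow> x \<in> V \<and> (x = 0 \<or> inverse x \<notin> V)"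
begin

lemma zero_V: "0 \<in> V"
  using diff_V[OF one_V one_V] by simp

lemma uminus_V: "x \<in> V \<Longrightarrow> - x \<in> V"
  using diff_V[OF zero_V, of x] by simp

lemma add_V: "x \<in> V \<Longrightarrow> y \<in> V \<Longrightarrow> x + y \<in> V"
  using diff_V[OF _ uminus_V, of x y] by simp

lemma sum_V: "(\<And>i. i \<in> A \<Longrightarrow> h i \<in> V) \<Longrightarrow> sum h A \<in> V"
  by (induction A rule: infinite_finite_induct) (auto intro: zero_V add_V)

lemma power_V: "x \<in> V \<Longrightarrow> x ^ n \<in> V"
  by (induction n) (auto intro: one_V mult_V)

lemma M_subset_V: "x \<in> M \<Longrightarrow> x \<in> V"
  using M_iff by blast

lemma zero_M: "0 \<in> M"
  using M_iff zero_V by blast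

lemma one_notin_M: "1 \<notin> M"
  using M_iff one_V by simp

lemma unit_inverse_V: "x \<in> V \<Longrightarrow> x \<notin> M \<Longrightarrow> inverse x \<in> V"
  using M_iff by blast

lemma inverse_M: "x \<notin> V \<Longrightarrow> inverse x \<in> M"
  using M_iff[of "inverse x"] inverse_V[of x] zero_V by auto

lemma divide_cases: "x / y \<in> V \<or> y / x \<in> M"
  using inverse_M[of "x / y"] by (auto simp: divide_inverse mult.commute)

lemma divide_total: "x / y \<in> V \<or> y / x \<in> V"
  using divide_cases M_subset_V by blast

lemma mult_M:
  assumes "x \<in> V" "m \<in> M"
  shows "x * m \<in> M"
proof (rule ccontr)
  assume a: "x * m \<notin> M"
  have "x * m \<in> V" using assms M_subset_V mult_V by blast
  with a have "inverse (x * m) \<in> V" "x * m \<noteq> 0"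
    using unit_inverse_V[of "x * m"] zero_M by metis+
  then have "x * inverse (x * m) \<in> V" and "m \<noteq> 0" "x \<noteq> 0" using assms mult_V by auto
  then have "inverse m \<in> V" by (simp add: field_simps)
  then show False using assms \<open>m \<noteq> 0\<close> M_iff by blast
qed

lemma mult_M': "m \<in> M \<Longrightarrow> x \<in> V \<Longrightarrow> m * x \<in> M"
  using mult_M by (metis mult.commute)

lemma uminus_M: "m \<in> M \<Longrightarrow> - m \<in> M"
  using mult_M[of "- 1" m] uminus_V[OF one_V] by simp

lemma add_M:
  assumes "x \<in> M" "y \<in> M"
  shows "x + y \<in> M"
proof -
  have *: "x + y \<in> M" if "x \<in> M" "y \<in> M" "x / y \<in> V" for x y
  proof (cases "y = 0")
    case False
    have "(x / y + 1) * y \<in> M" using that by (intro mult_M add_V one_V)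
    moreover have "(x / y + 1) * y = x + y" using False by (simp add: field_simps)
    ultimately show ?thesis by simp
  qed (use that in simp)
  show ?thesis
    using *[of x y] *[of y x] assms divide_total[of x y] by (auto simp: add.commute)
qed

lemma diff_M: "x \<in> M \<Longrightarrow> y \<in> M \<Longrightarrow> x - y \<in> M"
  using add_M[of x "- y"] uminus_M by simp

lemma sum_M: "(\<And>i. i \<in> A \<Longrightarrow> h i \<in> M) \<Longrightarrow> sum h A \<in> M"
  by (induction A rule: infinite_finite_induct) (auto intro: zero_M add_M)

lemma unit_add_M: "u \<in> V \<Longrightarrow> u \<notin> M \<Longrightarrow> m \<in> M \<Longrightarrow> u + m \<notin> M"
  using diff_M[of "u + m" m] by auto

end

text \<open>The first condition says that the residue field is algebraically closed. The second one says that
  the maximal ideal is not principal: no element of it has the least positive value.\<close>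

locale valuation_ring_with_roots = valuation_ring V M for V M :: "'k::field set" +
  assumes root_mod_M: "\<And>p. coeffs_in V p \<Longrightarrow> lead_coeff p \<notin> M \<Longrightarrow> 0 < degree p \<Longrightarrow> \<exists>a\<in>V. poly p a \<in> M"
    and factor_in_M: "\<And>m. m \<in> M \<Longrightarrow> \<exists>s\<in>M. s \<noteq> 0 \<and> m / s \<in> M"
begin

text \<open>This is how finitely many errors are merged into one: an element of least value among them divides
  all. The divisor \<open>d\<close> is nonzero even if \<open>a = b = 0\<close>, since \<open>M\<close> is not the zero ideal.\<close>

lemma common_divisor_in_M:
  assumes "a \<in> M" "b \<in> M"
  obtains d where "d \<in> M" "d \<noteq> 0" "a / d \<in> V" "b / d \<in> V"
proof (cases "a = 0 \<and> b = 0")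
  case True
  then show ?thesis using factor_in_M[OF zero_M] that zero_V by auto
next
  case False
  then consider "a \<noteq> 0" "b / a \<in> V" | "b \<noteq> 0" "a / b \<in> V"
    using divide_total[of a b] zero_V by (metis div_0)
  then show ?thesis using that[of a] that[of b] assms one_V by cases auto
qed

text \<open>Below any positive value there is one whose \<open>n\<close>-fold multiple is still below it. In each step of the
  induction, the smaller of the two values of \<open>s\<close> and of \<open>m / s ^ n\<close> has an \<open>(n + 1)\<close>-fold multiple
  that is at most the value of \<open>m\<close>; decreasing it once more leaves a remainder in \<open>M\<close>.\<close>

lemma power_divides_in_M:
  assumes "m \<in> M"
  obtains s where "s \<in> M" "s \<noteq> 0" "m / s ^ n \<in> M"
proof -
  have "\<exists>s\<in>M. s \<noteq> 0 \<and> m / s ^ n \<in> M"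
  proof (induction n)
    case 0
    show ?case using factor_in_M[OF assms] assms by auto
  next
    case (Suc n)
    then obtain s where s: "s \<in> M" "s \<noteq> 0" "m / s ^ n \<in> M" by blast
    obtain r where r: "r \<in> M" "r \<noteq> 0" "s / r \<in> V" "(m / s ^ n) / r \<in> V"
      using common_divisor_in_M[OF s(1,3)] by blast
    obtain q where q: "q \<in> M" "q \<noteq> 0" "r / q \<in> M" using factor_in_M[OF r(1)] by blast
    have "(s / r) ^ n * ((m / s ^ n) / r) * ((r / q) ^ n * (r / q)) \<in> M"
      by (intro mult_M mult_V power_V r(3,4) M_subset_V[OF q(3)] q(3))
    also have "(s / r) ^ n * ((m / s ^ n) / r) * ((r / q) ^ n * (r / q)) = m / q ^ Suc n"
      using s(2) r(2) q(2) by (simp add: field_simps power_divide)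
    finally show ?case using q by blast
  qed
  then show ?thesis using that by blast
qed

section \<open>Polynomials modulo the maximal ideal\<close>

lemma coeffs_in_V_arith:
  assumes "coeffs_in V A" "coeffs_in V B"
  shows "coeffs_in V (A + B)" "coeffs_in V (A - B)" "coeffs_in V (A * B)"
  using assms unfolding coeffs_in_def
  by (auto intro!: add_V diff_V mult_V sum_V simp: coeff_mult)

lemma coeffs_in_M_arith:
  assumes "coeffs_in M A" "coeffs_in M B"
  shows "coeffs_in M (A + B)" "coeffs_in M (A - B)"
  using assms unfolding coeffs_in_def by (auto intro!: add_M diff_M)

lemma coeffs_in_M_mult:
  assumes "coeffs_in V A" "coeffs_in M B"
  shows "coeffs_in M (A * B)"
  using assms unfolding coeffs_in_def by (auto intro!: sum_M mult_M simp: coeff_mult)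

lemma coeffs_in_M_imp_V: "coeffs_in M A \<Longrightarrow> coeffs_in V A"
  unfolding coeffs_in_def using M_subset_V by blast

lemma coeffs_in_const: "c \<in> V \<Longrightarrow> coeffs_in V [:c:]" "c \<in> M \<Longrightarrow> coeffs_in M [:c:]"
  unfolding coeffs_in_def using zero_V zero_M by (auto simp: coeff_pCons split: nat.split)

lemma poly_V: "coeffs_in V A \<Longrightarrow> y \<in> V \<Longrightarrow> poly A y \<in> V"
  unfolding poly_altdef coeffs_in_def by (auto intro!: sum_V mult_V power_V)

lemma poly_M: "coeffs_in M A \<Longrightarrow> y \<in> V \<Longrightarrow> poly A y \<in> M"
  unfolding poly_altdef coeffs_in_def by (auto intro!: sum_M mult_M' power_V)

lemma coeffs_in_synthetic_div:
  assumes "coeffs_in V A" "a \<in> V"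
  shows "coeffs_in V (synthetic_div A a)"
  using assms(1)
proof (induction A)
  case 0
  then show ?case by simp
next
  case (pCons c A)
  have A: "coeffs_in V A"
    using pCons.prems unfolding coeffs_in_def by (metis coeff_pCons_Suc)
  then show ?case
    using pCons.IH poly_V[OF A assms(2)] unfolding coeffs_in_def
    by (auto simp: coeff_pCons split: nat.split)
qed

lemma poly_diff_multiple:
  assumes "coeffs_in V A" "x \<in> V" "y \<in> V"
  obtains w where "w \<in> V" "poly A x = poly A y + (x - y) * w"
proof
  show "poly (synthetic_div A y) x \<in> V"
    using assms by (intro poly_V coeffs_in_synthetic_div)
  show "poly A x = poly A y + (x - y) * poly (synthetic_div A y) x"
    by (subst synthetic_div_correct'[of y A, symmetric]) (simp add: algebra_simps)
qed

lemma coeffs_in_M_common_factor: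
  assumes "coeffs_in M A"
  obtains d B where "d \<in> M" "d \<noteq> 0" "coeffs_in V B" "A = smult d B"
proof -
  have "\<exists>d\<in>M. d \<noteq> 0 \<and> (\<exists>B. coeffs_in V B \<and> A = smult d B)"
    using assms
  proof (induction A)
    case 0
    obtain s where "s \<in> M" "s \<noteq> 0" using factor_in_M[OF zero_M] by blast
    then show ?case using coeffs_in_const(1)[OF zero_V] by (intro bexI[of _ s]) auto
  next
    case (pCons c A)
    have c: "c \<in> M" and "coeffs_in M A"
      using pCons.prems unfolding coeffs_in_def by (metis coeff_pCons_0, metis coeff_pCons_Suc)
    then obtain d B where d: "d \<in> M" "d \<noteq> 0" "coeffs_in V B" "A = smult d B"
      using pCons.IH by blast
    obtain e where e: "e \<in> M" "e \<noteq> 0" "c / e \<in> V" "d / e \<in> V"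
      using common_divisor_in_M[OF c d(1)] by blast
    have "coeffs_in V (pCons (c / e) (smult (d / e) B))"
      using d(3) e(3,4) unfolding coeffs_in_def
      by (auto simp: coeff_pCons intro!: mult_V split: nat.split)
        (metis mult_V times_divide_eq_left)
    moreover have "pCons c A = smult e (pCons (c / e) (smult (d / e) B))"
      using e(2) d(4) by simp
    ultimately show ?case using e by blast
  qed
  then show ?thesis using that by blast
qed

text \<open>A residue polynomial is represented by a polynomial whose degree does not drop modulo \<open>M\<close>, which
  is obtained by deleting leading terms with coefficients in \<open>M\<close>.\<close>

lemma unit_lead_coeff_representative:
  assumes "coeffs_in V A"
  obtains B where "coeffs_in V B" "coeffs_in M (A - B)" "B = 0 \<or> lead_coeff B \<notin> M"
proof -
  have "\<exists>B. coeffs_in V B \<and> coeffs_in M (A - B) \<and> (B = 0 \<or> lead_coeff B \<notin> M)"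
    using assms
  proof (induction "degree A" arbitrary: A rule: less_induct)
    case less
    have M0: "coeffs_in M 0" unfolding coeffs_in_def using zero_M by simp
    have V0: "coeffs_in V 0" unfolding coeffs_in_def using zero_V by simp
    show ?case
    proof (cases "lead_coeff A \<in> M")
      case False
      then show ?thesis using less.prems M0 by (intro exI[of _ A]) simp
    next
      case True
      define T where "T = monom (lead_coeff A) (degree A)"
      have T: "coeffs_in M T"
        unfolding T_def coeffs_in_def using True zero_M by simp
      have lower: "coeffs_in V (A - T)"
        using coeffs_in_V_arith(2)[OF less.prems coeffs_in_M_imp_V[OF T]] .
      show ?thesis
      proof (cases "degree A = 0")
        case True
        then have "A = T" unfolding T_def by (metis degree_0_id monom_0)
        then show ?thesis using T V0 by (intro exI[of _ 0]) simp
      next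
        case False
        have "degree (A - T) < degree A"
        proof (rule degree_lessI)
          show "A - T \<noteq> 0 \<or> degree A > 0" using False by simp
          show "\<forall>k\<ge>degree A. coeff (A - T) k = 0"
            unfolding T_def by (auto simp: coeff_eq_0)
        qed
        from less.hyps[OF this lower] obtain B where
          B: "coeffs_in V B" "coeffs_in M (A - T - B)" "B = 0 \<or> lead_coeff B \<notin> M" by blast
        have "coeffs_in M (A - T - B + T)" using coeffs_in_M_arith(1)[OF B(2) T] .
        then show ?thesis using B by (intro exI[of _ B]) (simp add: algebra_simps)
      qed
    qed
  qed
  then show ?thesis using that by blast
qed

section \<open>Integral quotients of polynomials have polynomial reductions\<close>

text \<open>If \<open>y - a\<close> has a larger value than \<open>s\<close>, then \<open>y + s - a\<close> has the same value as \<open>s\<close>; otherwise \<open>y\<close>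
  itself will do.\<close>

lemma nearby_point_avoiding:
  assumes "s \<in> M" "s \<noteq> 0" "a \<in> V" "y \<in> V"
  obtains y' where "y' \<in> V" "(y' - y) / s \<in> V" "y' \<noteq> a" "s / (y' - a) \<in> V"
proof (cases "y \<noteq> a \<and> s / (y - a) \<in> V")
  case True
  then show ?thesis using that[of y] assms zero_V by simp
next
  case False
  then have m: "(y - a) / s \<in> M" using divide_cases[of s "y - a"] zero_M by auto
  define u where "u = 1 + (y - a) / s"
  have u: "u \<in> V" "u \<notin> M"
    unfolding u_def using add_V[OF one_V M_subset_V[OF m]] unit_add_M[OF one_V one_notin_M m] by auto
  then have "u \<noteq> 0" using zero_M by auto
  have eq: "y + s - a = s * u" unfolding u_def using assms(2) by (simp add: field_simps)
  show ?thesis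
  proof (rule that[of "y + s"])
    show "y + s \<in> V" using assms add_V M_subset_V by blast
    show "(y + s - y) / s \<in> V" using one_V assms(2) by simp
    show "y + s \<noteq> a" using eq \<open>u \<noteq> 0\<close> assms(2) by auto
    have "s / (y + s - a) = inverse u"
      unfolding eq using assms(2) by (simp add: field_simps)
    then show "s / (y + s - a) \<in> V" using unit_inverse_V[OF u] by simp
  qed
qed

text \<open>The condition \<open>poly P y \<in> poly Q y V\<close> on \<open>V\<close>, weakened by a uniform error \<open>d \<in> M\<close>. The error makes
  the condition depend on \<open>P\<close> and \<open>Q\<close> modulo \<open>M\<close> only, and it is what allows linear factors to be
  cancelled.\<close>

definition quotient_integral_mod_M :: "'k poly \<Rightarrow> 'k poly \<Rightarrow> bool"
  where "quotient_integral_mod_M P Q \<longleftrightarrow>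
    (\<exists>d\<in>M. \<forall>y\<in>V. \<exists>r\<in>V. \<exists>w\<in>V. poly P y = r * poly Q y + d * w)"

text \<open>If \<open>a\<close> is a root of \<open>Q\<close> modulo \<open>M\<close>, then it is one of \<open>P\<close>, and \<open>x - a\<close> can be cancelled. Dividing
  by \<open>y - a\<close> enlarges the error, but harmlessly so if \<open>y - a\<close> divides an \<open>s\<close> whose square divides the old
  error. All other points are compared with such a point that differs from them by a multiple of \<open>s\<close>;
  polynomials over \<open>V\<close> then change by multiples of \<open>s\<close> as well. Hence \<open>s\<close> serves as the new error.\<close>

lemma quotient_integral_mod_M_cancel:
  assumes V: "coeffs_in V P" "coeffs_in V Q" "a \<in> V" and "poly Q a \<in> M"
    and integral: "quotient_integral_mod_M P Q"
  shows "poly P a \<in> M" and "quotient_integral_mod_M (synthetic_div P a) (synthetic_div Q a)"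
proof -
  obtain d where d: "d \<in> M"
    and d_approx: "\<And>y. y \<in> V \<Longrightarrow> \<exists>r\<in>V. \<exists>w\<in>V. poly P y = r * poly Q y + d * w"
    using integral unfolding quotient_integral_mod_M_def by blast
  show Pa: "poly P a \<in> M"
    using d_approx[OF V(3)] add_M mult_M mult_M' assms(4) d by metis
  \<comment> \<open>The error \<open>c\<close> also absorbs the remainders of \<open>P\<close> and \<open>Q\<close> upon division by \<open>x - a\<close>.\<close>
  obtain e where e: "e \<in> M" "e \<noteq> 0" "poly P a / e \<in> V" "poly Q a / e \<in> V"
    using common_divisor_in_M[OF Pa assms(4)] by blast
  obtain c where c: "c \<in> M" "c \<noteq> 0" "d / c \<in> V" "e / c \<in> V"
    using common_divisor_in_M[OF d e(1)] by blast
  have split: "poly A y = (y - a) * poly (synthetic_div A a) y + poly A a" for A :: "'k poly" and y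
    by (subst synthetic_div_correct'[of a A, symmetric]) (simp add: algebra_simps)
  have Pc: "poly P a / c \<in> V"
    using mult_V[OF e(3) c(4)] e(2) by simp
  have Qc: "poly Q a / c \<in> V"
    using mult_V[OF e(4) c(4)] e(2) by simp
  obtain s where s: "s \<in> M" "s \<noteq> 0" "c / s ^ 2 \<in> M"
    using power_divides_in_M[OF c(1)] by blast
  let ?P = "synthetic_div P a" and ?Q = "synthetic_div Q a"
  have PQ_V: "coeffs_in V ?P" "coeffs_in V ?Q"
    using V coeffs_in_synthetic_div by blast+
  have "\<exists>r\<in>V. \<exists>w\<in>V. poly ?P y = r * poly ?Q y + s * w" if y: "y \<in> V" for y
  proof -
    obtain y' where y': "y' \<in> V" "(y' - y) / s \<in> V" "y' \<noteq> a" "s / (y' - a) \<in> V"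
      using nearby_point_avoiding[OF s(1,2) V(3) y] by blast
    obtain r w where r: "r \<in> V" "w \<in> V" "poly P y' = r * poly Q y' + d * w"
      using d_approx[OF y'(1)] by blast
    obtain p where p: "p \<in> V" "poly ?P y' = poly ?P y + (y' - y) * p"
      using poly_diff_multiple[OF PQ_V(1) y'(1) y] by blast
    obtain q where q: "q \<in> V" "poly ?Q y' = poly ?Q y + (y' - y) * q"
      using poly_diff_multiple[OF PQ_V(2) y'(1) y] by blast
    define v where "v = r * (poly Q a / c) + (d / c) * w - poly P a / c"
    have v: "v \<in> V" unfolding v_def by (intro add_V diff_V mult_V r Pc Qc c(3))
    have "(y' - a) * poly ?P y' = (y' - a) * (r * poly ?Q y') + c * v"
      using split[of P y'] split[of Q y'] r(3) c(2) unfolding v_def by (simp add: algebra_simps)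
    then have "poly ?P y' = r * poly ?Q y' + c * v / (y' - a)"
      using y'(3) by (simp add: field_simps)
    moreover define b where "b = (c / s ^ 2) * (s / (y' - a)) * v"
    have "c * v / (y' - a) = s * b"
      unfolding b_def using s(2) by (simp add: power2_eq_square)
    moreover define k where "k = (y' - y) / s"
    have "y' - y = s * k" unfolding k_def using s(2) by simp
    ultimately have "poly ?P y = r * poly ?Q y + s * (r * (k * q) + b - k * p)"
      using p(2) q(2) by (simp add: algebra_simps)
    moreover have "r * (k * q) + b - k * p \<in> V"
      unfolding b_def k_def by (intro add_V diff_V mult_V r(1) y' q(1) p(1) v M_subset_V[OF s(3)])
    ultimately show ?thesis using r(1) by blast
  qed
  then show "quotient_integral_mod_M ?P ?Q"
    unfolding quotient_integral_mod_M_def using s(1) by blast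
qed

text \<open>Over the algebraically closed residue field \<open>Q\<close> splits into linear factors, which are cancelled one
  after the other.\<close>

lemma quotient_integral_imp_dvd_unit_lead:
  assumes "coeffs_in V P" "coeffs_in V Q" "lead_coeff Q \<notin> M" "quotient_integral_mod_M P Q"
  shows "\<exists>C. coeffs_in V C \<and> coeffs_in M (P - C * Q)"
  using assms
proof (induction "degree Q" arbitrary: P Q)
  case 0
  then obtain u where Q: "Q = [:u:]" by (metis degree_eq_zeroE)
  have u: "u \<in> V" "u \<notin> M" using 0 Q unfolding coeffs_in_def by (metis coeff_pCons_0, simp)
  then have "u \<noteq> 0" using zero_M by auto
  have "P - (P * [:inverse u:]) * Q = 0" using \<open>u \<noteq> 0\<close> by (simp add: Q)
  moreover have "coeffs_in V (P * [:inverse u:])"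
    by (intro coeffs_in_V_arith(3) coeffs_in_const(1) unit_inverse_V u 0)
  ultimately show ?case unfolding coeffs_in_def[of M] using zero_M by (metis coeff_0)
next
  case (Suc n)
  obtain a where a: "a \<in> V" "poly Q a \<in> M" using root_mod_M[of Q] Suc by auto
  let ?P = "synthetic_div P a" and ?Q = "synthetic_div Q a"
  have split: "A = [:- a, 1:] * synthetic_div A a + [:poly A a:]" for A :: "'k poly"
    by (rule synthetic_div_correct'[symmetric])
  note cancel = quotient_integral_mod_M_cancel[OF Suc.prems(1,2) a Suc.prems(4)]
  have deg: "n = degree ?Q" using Suc.hyps(2) by (simp add: degree_synthetic_div)
  have "?Q \<noteq> 0" using Suc.hyps(2) by (auto simp: synthetic_div_eq_0_iff)
  have "lead_coeff ([:- a, 1:] * ?Q) = lead_coeff ?Q" by (simp only: lead_coeff_mult) simp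
  moreover have "degree ([:- a, 1:] * ?Q) = Suc n"
    using \<open>?Q \<noteq> 0\<close> deg by (subst degree_mult_eq) auto
  ultimately have "lead_coeff ?Q = coeff ([:- a, 1:] * ?Q) (Suc n)" by simp
  also have "\<dots> = lead_coeff Q"
    using arg_cong[OF split[of Q], of "\<lambda>A. coeff A (Suc n)"] Suc.hyps(2)[symmetric]
    by (simp del: mult_pCons_left)
  finally have lead: "lead_coeff ?Q \<notin> M" using Suc.prems(3) by simp
  obtain C where C: "coeffs_in V C" "coeffs_in M (?P - C * ?Q)"
    using Suc.hyps(1)[OF deg coeffs_in_synthetic_div[OF Suc.prems(1) a(1)]
        coeffs_in_synthetic_div[OF Suc.prems(2) a(1)] lead cancel(2)] by blast
  have "P - C * Q = [:- a, 1:] * (?P - C * ?Q) + ([:poly P a:] - C * [:poly Q a:])"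
    by (subst split[of P], subst split[of Q]) (simp add: algebra_simps)
  moreover have "coeffs_in V [:- a, 1:]"
    unfolding coeffs_in_def using a(1) one_V zero_V uminus_V
    by (auto simp: coeff_pCons split: nat.split)
  ultimately have "coeffs_in M (P - C * Q)"
    using coeffs_in_M_arith(1)[OF coeffs_in_M_mult[OF _ C(2)]
        coeffs_in_M_arith(2)[OF coeffs_in_const(2)[OF cancel(1)]
          coeffs_in_M_mult[OF C(1) coeffs_in_const(2)[OF a(2)]]]]
    by (simp only:)
  then show ?case using C(1) by blast
qed

text \<open>A rational function that is integral on \<open>V\<close> reduces to a polynomial modulo \<open>M\<close>: its reduction has no
  pole in the residue field.\<close>

lemma quotient_integral_imp_dvd:
  assumes "coeffs_in V P" "coeffs_in V Q" "\<not> coeffs_in M Q"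
    and "\<And>y. y \<in> V \<Longrightarrow> \<exists>r\<in>V. poly P y = r * poly Q y"
  shows "\<exists>C. coeffs_in V C \<and> coeffs_in M (P - C * Q)"
proof -
  obtain Q0 where Q0: "coeffs_in V Q0" "coeffs_in M (Q - Q0)" "Q0 = 0 \<or> lead_coeff Q0 \<notin> M"
    using unit_lead_coeff_representative[OF assms(2)] by blast
  then have lead: "lead_coeff Q0 \<notin> M" using assms(3) by auto
  obtain d B where d: "d \<in> M" "coeffs_in V B" "Q - Q0 = smult d B"
    using coeffs_in_M_common_factor[OF Q0(2)] by metis
  have "\<exists>r\<in>V. \<exists>w\<in>V. poly P y = r * poly Q0 y + d * w" if y: "y \<in> V" for y
  proof -
    obtain r where r: "r \<in> V" "poly P y = r * poly Q y" using assms(4)[OF y] by blast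
    have "poly Q y = poly Q0 y + d * poly B y"
      using arg_cong[OF d(3), of "\<lambda>p. poly p y"] by (simp add: algebra_simps)
    then have "poly P y = r * poly Q0 y + d * (r * poly B y)"
      using r by (simp add: algebra_simps)
    then show ?thesis using r(1) mult_V poly_V[OF d(2) y] by blast
  qed
  then have "quotient_integral_mod_M P Q0" unfolding quotient_integral_mod_M_def using d(1) by blast
  then obtain C where C: "coeffs_in V C" "coeffs_in M (P - C * Q0)"
    using quotient_integral_imp_dvd_unit_lead[OF assms(1) Q0(1) lead] by blast
  have "coeffs_in M ((P - C * Q0) - C * (Q - Q0))"
    by (intro coeffs_in_M_arith coeffs_in_M_mult C Q0)
  then show ?thesis using C(1) by (intro exI[of _ C]) (simp add: algebra_simps)
qed

text \<open>The residue field is infinite. Concretely, a residue polynomial that is not constant takes the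
  value \<open>1\<close>, because subtracting \<open>1\<close> from it leaves a polynomial with a root.\<close>

lemma poly_in_M_everywhere_imp_coeffs_in_M:
  assumes "coeffs_in V P" "\<And>y. y \<in> V \<Longrightarrow> poly P y \<in> M"
  shows "coeffs_in M P"
proof -
  obtain P0 where P0: "coeffs_in V P0" "coeffs_in M (P - P0)" "P0 = 0 \<or> lead_coeff P0 \<notin> M"
    using unit_lead_coeff_representative[OF assms(1)] by blast
  have val: "poly P0 y \<in> M" if "y \<in> V" for y
    using diff_M[OF assms(2)[OF that] poly_M[OF P0(2) that]] by simp
  have "P0 = 0"
  proof (rule ccontr)
    assume "P0 \<noteq> 0"
    then have lead: "lead_coeff P0 \<notin> M" using P0 by blast
    show False
    proof (cases "degree P0 = 0")
      case True
      then obtain u where "P0 = [:u:]" by (metis degree_eq_zeroE)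
      then show False using val[OF zero_V] lead by simp
    next
      case False
      have deg: "degree (P0 + [:- 1:]) = degree P0" using False by (intro degree_add_eq_left) simp
      then have "lead_coeff (P0 + [:- 1:]) = lead_coeff P0"
        using False by (simp add: coeff_pCons split: nat.split)
      then obtain a where a: "a \<in> V" "poly (P0 + [:- 1:]) a \<in> M"
        using root_mod_M[of "P0 + [:- 1:]"] lead False deg
          coeffs_in_V_arith(1)[OF P0(1) coeffs_in_const(1)[OF uminus_V[OF one_V]]] by auto
      then show False using diff_M[OF val[OF a(1)] a(2)] one_notin_M by simp
    qed
  qed
  then show ?thesis using P0(2) by simp
qed

section \<open>Behaviour at infinity\<close>

lemma poly_inverse_scaled:
  assumes "coeffs_in V A" "degree A \<le> n" "z \<in> V" "z \<noteq> 0"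
  shows "z ^ n * poly A (inverse z) \<in> V"
proof -
  have "z ^ n * poly A (inverse z) = (\<Sum>i\<le>degree A. coeff A i * z ^ (n - i))"
    unfolding poly_altdef sum_distrib_left
  proof (rule sum.cong)
    fix i assume "i \<in> {..degree A}"
    then have "z ^ n = z ^ (n - i) * z ^ i"
      using assms(2) by (simp flip: power_add)
    then show "z ^ n * (coeff A i * inverse z ^ i) = coeff A i * z ^ (n - i)"
      using assms(4) by (simp add: field_simps)
  qed simp
  also have "\<dots> \<in> V"
    using assms unfolding coeffs_in_def by (auto intro!: sum_V mult_V power_V)
  finally show ?thesis .
qed

text \<open>If the leading coefficient of \<open>A\<close> is a unit, then at a point \<open>1 / z\<close> of negative value the leading
  term alone determines the value of \<open>A\<close>.\<close>

lemma unit_lead_coeff_poly_inverse: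
  assumes "coeffs_in V A" "lead_coeff A \<notin> M" "z \<in> M" "z \<noteq> 0"
  shows "z ^ degree A * poly A (inverse z) \<notin> M"
proof -
  have R: "coeffs_in V (reflect_poly A)"
    using assms(1) zero_V unfolding coeffs_in_def by (simp add: coeff_reflect_poly)
  obtain w where "w \<in> V" "poly (reflect_poly A) z = poly (reflect_poly A) 0 + (z - 0) * w"
    using poly_diff_multiple[OF R M_subset_V[OF assms(3)] zero_V] by blast
  then have "poly (reflect_poly A) z = lead_coeff A + z * w"
    by (simp add: poly_0_coeff_0)
  then have "poly (reflect_poly A) z \<notin> M"
    using unit_add_M[of "lead_coeff A" "z * w"] mult_M'[OF assms(3) \<open>w \<in> V\<close>] assms(1,2)
    unfolding coeffs_in_def by auto
  then show ?thesis using poly_reflect_poly_nz[OF assms(4), of A] by simp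
qed

text \<open>The function \<open>f\<close> reduces to a polynomial \<open>C\<close> modulo \<open>M\<close>. At \<open>y = 1 / z\<close> the equation reads
  \<open>f y = z (1 - z g y)\<close>, so that \<open>f\<close> vanishes there to first order exactly. A nonzero
  polynomial does not vanish at infinity, whereas \<open>C = 0\<close> is too small: for \<open>z\<close> of sufficiently small
  value, \<open>f y\<close> and \<open>poly C y\<close> differ by an element of \<open>z M\<close>.\<close>

lemma no_integral_solution_primitive:
  assumes t: "t \<in> M" "t \<noteq> 0"
    and V: "coeffs_in V P" "coeffs_in V Q" and primitive: "\<not> coeffs_in M Q"
    and f: "\<And>y. t * y \<in> V \<Longrightarrow> f y \<in> V" and g: "\<And>y. t * y \<in> V \<Longrightarrow> g y \<in> V"
    and P: "\<And>y. t * y \<in> V \<Longrightarrow> poly P y = f y * poly Q y"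
    and eq: "\<And>y. t * y \<in> V \<Longrightarrow> y = y\<^sup>2 * f y + g y"
  shows False
proof -
  have "\<exists>r\<in>V. poly P y = r * poly Q y" if "y \<in> V" for y
    using P[of y] f[of y] mult_V[OF M_subset_V[OF t(1)] that] by blast
  then obtain C0 where C0: "coeffs_in V C0" "coeffs_in M (P - C0 * Q)"
    using quotient_integral_imp_dvd[OF V primitive] by blast
  obtain C where C: "coeffs_in V C" "coeffs_in M (C0 - C)" "C = 0 \<or> lead_coeff C \<notin> M"
    using unit_lead_coeff_representative[OF C0(1)] by blast
  have "coeffs_in M ((P - C0 * Q) + Q * (C0 - C))"
    by (intro coeffs_in_M_arith coeffs_in_M_mult C0 C V)
  then have "coeffs_in M (P - C * Q)" by (simp add: algebra_simps)
  then obtain d E where d: "d \<in> M" "d \<noteq> 0" "coeffs_in V E" "P - C * Q = smult d E"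
    using coeffs_in_M_common_factor by metis
  obtain Q0 where Q0: "coeffs_in V Q0" "coeffs_in M (Q - Q0)" "Q0 = 0 \<or> lead_coeff Q0 \<notin> M"
    using unit_lead_coeff_representative[OF V(2)] by blast
  then have lead: "lead_coeff Q0 \<notin> M" using primitive by auto
  obtain e F where e: "e \<in> M" "e \<noteq> 0" "coeffs_in V F" "Q - Q0 = smult e F"
    using coeffs_in_M_common_factor[OF Q0(2)] by metis
  obtain c where c: "c \<in> M" "c \<noteq> 0" "d / c \<in> V" "e / c \<in> V"
    using common_divisor_in_M[OF d(1) e(1)] by blast
  \<comment> \<open>The value of \<open>b\<close> bounds all errors, and also ensures that \<open>1 / z\<close> is an admissible point.\<close>
  obtain b where b: "b \<in> M" "b \<noteq> 0" "c / b \<in> V" "t / b \<in> V"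
    using common_divisor_in_M[OF c(1) t(1)] by blast
  have db: "d / b \<in> V" using mult_V[OF c(3) b(3)] c(2) by simp
  have eb: "e / b \<in> V" using mult_V[OF c(4) b(3)] c(2) by simp
  define N where "N = degree E + degree F"
  \<comment> \<open>The factor \<open>z ^ N\<close> clears the denominators of \<open>E\<close> and \<open>F\<close> at \<open>1 / z\<close>;
    the last factor \<open>z\<close> makes the errors smaller than \<open>z\<close> itself.\<close>
  obtain z where z: "z \<in> M" "z \<noteq> 0" "b / z ^ Suc N \<in> M"
    using power_divides_in_M[OF b(1)] by blast
  note zV = M_subset_V[OF z(1)]
  define y where "y = inverse z"
  define m where "m = b / z ^ Suc N"
  have m: "m \<in> M" and b_eq: "b = m * z ^ N * z"
    unfolding m_def using z by (auto simp: field_simps)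
  have "t * y = (t / b) * (m * z ^ N)"
    unfolding y_def using b_eq b(2) z(2) by (simp add: field_simps)
  then have ty: "t * y \<in> V"
    using b(4) mult_V power_V[OF zV] M_subset_V[OF m] by metis
  have EN: "z ^ N * poly E y \<in> V" and FN: "z ^ N * poly F y \<in> V"
    unfolding y_def using poly_inverse_scaled[OF d(3)] poly_inverse_scaled[OF e(3)] zV z(2)
    by (auto simp: N_def)
  \<comment> \<open>The denominator is a unit up to a power of \<open>z\<close>, as its reduction is not zero.\<close>
  define u where "u = z ^ degree Q0 * poly Q y"
  have "poly Q y = poly Q0 y + e * poly F y"
    using arg_cong[OF e(4), of "\<lambda>p. poly p y"] by (simp add: algebra_simps)
  then have "u = z ^ degree Q0 * poly Q0 y +
      z ^ degree Q0 * (e / b) * (z ^ N * poly F y) * z * m"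
    unfolding u_def using b_eq b(2) by (simp add: field_simps)
  moreover have "z ^ degree Q0 * poly Q0 y \<in> V" "z ^ degree Q0 * poly Q0 y \<notin> M"
    unfolding y_def using poly_inverse_scaled[OF Q0(1) order.refl zV z(2)]
      unit_lead_coeff_poly_inverse[OF Q0(1) lead z(1,2)] by auto
  moreover have "z ^ degree Q0 * (e / b) * (z ^ N * poly F y) * z * m \<in> M"
    by (intro mult_M m mult_V power_V zV eb FN)
  ultimately have u: "u \<in> V" "u \<notin> M" using add_V unit_add_M M_subset_V by metis+
  then have "u \<noteq> 0" using zero_M by auto
  define n where "n = inverse u * z ^ degree Q0 * (d / b) * (z ^ N * poly E y) * m"
  have n: "n \<in> M"
    unfolding n_def by (intro mult_M m mult_V power_V zV db EN unit_inverse_V u)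
  have "f y * poly Q y - poly C y * poly Q y = d * poly E y"
    using arg_cong[OF d(4), of "\<lambda>p. poly p y"] P[OF ty] by simp
  then have "z ^ degree Q0 * ((f y - poly C y) * poly Q y) = z ^ degree Q0 * (d * poly E y)"
    by (simp add: left_diff_distrib)
  then have "(f y - poly C y) * u = z ^ degree Q0 * d * poly E y"
    unfolding u_def by (simp add: mult_ac)
  then have "f y - poly C y = inverse u * z ^ degree Q0 * d * poly E y"
    using \<open>u \<noteq> 0\<close> by (simp add: field_simps)
  also have "\<dots> = z * n" unfolding n_def using b_eq b(2) by (simp add: field_simps)
  finally have fC: "f y - poly C y = z * n" .
  have "z = f y + z\<^sup>2 * g y"
  proof -
    have "z\<^sup>2 * y = z\<^sup>2 * (y\<^sup>2 * f y + g y)" using eq[OF ty] by simp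
    moreover have "z\<^sup>2 * y = z" "z\<^sup>2 * y\<^sup>2 = 1"
      unfolding y_def using z(2) by (simp_all add: field_simps power2_eq_square)
    ultimately show ?thesis by (simp add: distrib_left mult.assoc[symmetric])
  qed
  then have Cz: "poly C y = z * (1 - z * g y - n)"
    using fC by (simp add: algebra_simps power2_eq_square)
  have gn: "z * g y + n \<in> M" using add_M n mult_M'[OF z(1) g[OF ty]] by blast
  show False
  proof (cases "C = 0")
    case True
    then have "1 - z * g y - n = 0" using Cz z(2) by simp
    then have "z * g y + n = 1" by (simp add: algebra_simps)
    then show False using gn one_notin_M by simp
  next
    case False
    then have "z ^ degree C * poly C y \<notin> M"
      unfolding y_def using unit_lead_coeff_poly_inverse[OF C(1) _ z(1,2)] C(3) by blast
    moreover have "z * (1 - z * g y - n) \<in> M"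
      by (intro mult_M' z diff_V one_V M_subset_V[OF n] M_subset_V[OF mult_M'[OF z(1) g[OF ty]]])
    ultimately show False using Cz mult_M power_V[OF zV] by metis
  qed
qed

lemma finite_set_max_divisor:
  assumes "finite S" "\<exists>x\<in>S. x \<noteq> 0"
  shows "\<exists>c\<in>S. c \<noteq> 0 \<and> (\<forall>x\<in>S. x / c \<in> V)"
  using assms
proof (induction S)
  case (insert a S)
  show ?case
  proof (cases "\<exists>x\<in>S. x \<noteq> 0")
    case False
    then show ?thesis using insert.prems one_V zero_V by (intro bexI[of _ a]) auto
  next
    case True
    then obtain c where c: "c \<in> S" "c \<noteq> 0" "\<forall>x\<in>S. x / c \<in> V" using insert.IH by blast
    show ?thesis
    proof (cases "a / c \<in> V")
      case True
      then show ?thesis using c by (intro bexI[of _ c]) auto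
    next
      case False
      then have a: "a \<noteq> 0" "c / a \<in> V" using divide_total[of a c] zero_V by auto
      have "x / a \<in> V" if "x \<in> S" for x
      proof -
        have "(x / c) * (c / a) \<in> V" using c(3) that a(2) mult_V by blast
        then show ?thesis using c(2) by simp
      qed
      then show ?thesis using a one_V by (intro bexI[of _ a]) auto
    qed
  qed
qed simp

text \<open>After dividing \<open>P\<close> and \<open>Q\<close> by a coefficient of least value, they have coefficients in \<open>V\<close> and one of
  them is nonzero modulo \<open>M\<close>. If \<open>Q\<close> were zero modulo \<open>M\<close>, then the values of \<open>P\<close> on \<open>V\<close>, being multiples
  of those of \<open>Q\<close>, would all lie in \<open>M\<close>, and so would its coefficients.\<close>

lemma no_integral_solution:
  assumes t: "t \<in> M" "t \<noteq> 0" and "Q \<noteq> 0"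
    and f: "\<And>y. t * y \<in> V \<Longrightarrow> f y \<in> V" and g: "\<And>y. t * y \<in> V \<Longrightarrow> g y \<in> V"
    and P: "\<And>y. t * y \<in> V \<Longrightarrow> poly P y = f y * poly Q y"
    and eq: "\<And>y. t * y \<in> V \<Longrightarrow> y = y\<^sup>2 * f y + g y"
  shows False
proof -
  define S where "S = set (coeffs P) \<union> set (coeffs Q)"
  have "lead_coeff Q \<in> S" "lead_coeff Q \<noteq> 0"
    unfolding S_def using assms(3) by (auto simp: coeff_in_coeffs)
  moreover have "finite S" unfolding S_def by simp
  ultimately obtain c where c: "c \<in> S" "c \<noteq> 0" "\<forall>x\<in>S. x / c \<in> V"
    using finite_set_max_divisor[of S] by blast
  define P1 Q1 where "P1 = smult (inverse c) P" and "Q1 = smult (inverse c) Q"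
  have "coeff P i / c \<in> V" "coeff Q i / c \<in> V" for i
    using c(3) zero_V unfolding S_def
    by (metis UnI1 coeff_in_coeffs coeff_eq_0 coeff_0 div_0 le_degree,
        metis UnI2 coeff_in_coeffs coeff_eq_0 coeff_0 div_0 le_degree)
  then have V: "coeffs_in V P1" "coeffs_in V Q1"
    unfolding P1_def Q1_def coeffs_in_def by (auto simp: divide_inverse mult.commute)
  have "\<exists>i. coeff P1 i = 1 \<or> coeff Q1 i = 1"
  proof -
    obtain i where "c = coeff P i \<or> c = coeff Q i"
      using c(1) unfolding S_def coeffs_def by (auto split: if_splits)
    then show ?thesis using c(2) unfolding P1_def Q1_def by (intro exI[of _ i]) auto
  qed
  then have prim: "\<not> coeffs_in M P1 \<or> \<not> coeffs_in M Q1"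
    unfolding coeffs_in_def using one_notin_M by metis
  have P1: "poly P1 y = f y * poly Q1 y" if "t * y \<in> V" for y
    unfolding P1_def Q1_def using P[OF that] by simp
  have "\<not> coeffs_in M Q1"
  proof
    assume Q1: "coeffs_in M Q1"
    have "poly P1 y \<in> M" if "y \<in> V" for y
    proof -
      have "t * y \<in> V" using mult_V M_subset_V t that by blast
      then show ?thesis using P1 f mult_M poly_M[OF Q1 that] by simp
    qed
    then show False using poly_in_M_everywhere_imp_coeffs_in_M[OF V(1)] prim Q1 by blast
  qed
  then show False by (rule no_integral_solution_primitive[OF t V _ f g P1 eq])
qed

end

section \<open>Rings and ideals inside a type\<close>

lemma ring_on_simps [simp]:
  "carrier (ring_on S) = S" "x \<otimes>\<^bsub>ring_on S\<^esub> y = x * y" "\<one>\<^bsub>ring_on S\<^esub> = 1"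
  "\<zero>\<^bsub>ring_on S\<^esub> = 0" "x \<oplus>\<^bsub>ring_on S\<^esub> y = x + y"
  by (simp_all add: ring_on_def ring_of_type_algebra_def)

lemma ring_on_nat_pow [simp]: "x [^]\<^bsub>ring_on S\<^esub> (n::nat) = x ^ n"
  by (induction n) (simp_all add: nat_pow_def mult.commute)

lemma cring_ring_on:
  assumes one: "1 \<in> S" and diff: "\<And>x y. x \<in> S \<Longrightarrow> y \<in> S \<Longrightarrow> x - y \<in> S"
    and mult: "\<And>x y. x \<in> S \<Longrightarrow> y \<in> S \<Longrightarrow> x * y \<in> S"
  shows "cring (ring_on S)"
proof -
  have zero: "0 \<in> S" using diff[OF one one] by simp
  have uminus: "- x \<in> S" if "x \<in> S" for x using diff[OF zero that] by simp
  have add: "x + y \<in> S" if "x \<in> S" "y \<in> S" for x y using diff[OF that(1) uminus[OF that(2)]] by simp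
  have neg: "\<exists>y\<in>S. y + x = 0 \<and> x + y = 0" if "x \<in> S" for x
    using uminus[OF that] by (intro bexI[of _ "- x"]) auto
  show ?thesis
    by unfold_locales (use zero one mult add neg in \<open>auto simp: algebra_simps Units_def\<close>)
qed

lemma ideal_ring_onI:
  assumes R: "cring (ring_on S)" and sub: "I \<subseteq> S" and zero_I: "0 \<in> I"
    and add_I: "\<And>x y. x \<in> I \<Longrightarrow> y \<in> I \<Longrightarrow> x + y \<in> I"
    and mult_I: "\<And>r x. r \<in> S \<Longrightarrow> x \<in> I \<Longrightarrow> r * x \<in> I"
  shows "ideal I (ring_on S)"
proof -
  interpret cring "ring_on S" by (rule R)
  have inv: "\<ominus>\<^bsub>ring_on S\<^esub> x = - 1 * x" if "x \<in> S" for x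
    using r_neg[of x] that by (simp add: eq_neg_iff_add_eq_0 add.commute)
  have m1: "- 1 \<in> S"
    using inv[of 1] a_inv_closed[of 1] one_closed by simp
  show ?thesis
  proof (rule idealI[OF ring_axioms])
    show "subgroup I (add_monoid (ring_on S))"
    proof
      show "inv\<^bsub>add_monoid (ring_on S)\<^esub> x \<in> I" if "x \<in> I" for x
        using inv[of x] mult_I[OF m1 that] that sub unfolding a_inv_def by auto
    qed (use sub zero_I add_I in auto)
  qed (use mult_I in \<open>auto, metis mult.commute\<close>)
qed

lemma Idl_ring_on_triple:
  assumes R: "cring (ring_on S)" and S: "u \<in> S" "v \<in> S" "w \<in> S"
  shows "Idl\<^bsub>ring_on S\<^esub> {u, v, w} = {u * x + v * y + w * z | x y z. x \<in> S \<and> y \<in> S \<and> z \<in> S}"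
    (is "_ = ?I")
proof -
  interpret cring "ring_on S" by (rule R)
  have closed: "\<And>x y. x \<in> S \<Longrightarrow> y \<in> S \<Longrightarrow> x * y \<in> S"
    "\<And>x y. x \<in> S \<Longrightarrow> y \<in> S \<Longrightarrow> x + y \<in> S" "0 \<in> S" "1 \<in> S"
    using m_closed a_closed zero_closed one_closed by simp_all
  have memI: "u * x + v * y + w * z \<in> ?I" if "x \<in> S" "y \<in> S" "z \<in> S" for x y z
    using that by blast
  have ideal: "ideal ?I (ring_on S)"
  proof (rule ideal_ring_onI[OF R])
    show "?I \<subseteq> S" by (auto intro!: S closed)
    show "0 \<in> ?I" using memI[OF closed(3) closed(3) closed(3)] by simp
    show "p + q \<in> ?I" if pq: "p \<in> ?I" "q \<in> ?I" for p q
    proof -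
      obtain x y z x' y' z' where "p = u * x + v * y + w * z" "q = u * x' + v * y' + w * z'"
        "x \<in> S" "y \<in> S" "z \<in> S" "x' \<in> S" "y' \<in> S" "z' \<in> S" using pq by blast
      then show ?thesis
        using memI[of "x + x'" "y + y'" "z + z'"] closed by (simp add: algebra_simps)
    qed
    show "r * p \<in> ?I" if rp: "r \<in> S" "p \<in> ?I" for r p
    proof -
      obtain x y z where "p = u * x + v * y + w * z" "x \<in> S" "y \<in> S" "z \<in> S" using rp(2) by blast
      then show ?thesis
        using memI[of "r * x" "r * y" "r * z"] rp(1) closed by (simp add: algebra_simps)
    qed
  qed
  show ?thesis
  proof
    have "{u, v, w} \<subseteq> ?I"
      using memI[of 1 0 0] memI[of 0 1 0] memI[of 0 0 1] closed by auto
    then show "Idl\<^bsub>ring_on S\<^esub> {u, v, w} \<subseteq> ?I" using genideal_minimal[OF ideal] by blast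
    have "{u, v, w} \<subseteq> carrier (ring_on S)" using S by simp
    then interpret J: ideal "Idl\<^bsub>ring_on S\<^esub> {u, v, w}" "ring_on S"
      by (rule genideal_ideal)
    have gens: "{u, v, w} \<subseteq> Idl\<^bsub>ring_on S\<^esub> {u, v, w}" using S by (intro genideal_self) simp
    show "?I \<subseteq> Idl\<^bsub>ring_on S\<^esub> {u, v, w}"
    proof
      fix p assume "p \<in> ?I"
      then obtain x y z where p: "p = u * x + v * y + w * z" and "x \<in> S" "y \<in> S" "z \<in> S" by blast
      then have "u * x \<in> Idl\<^bsub>ring_on S\<^esub> {u, v, w}" "v * y \<in> Idl\<^bsub>ring_on S\<^esub> {u, v, w}"
        "w * z \<in> Idl\<^bsub>ring_on S\<^esub> {u, v, w}"
        using J.I_r_closed[of u x] J.I_r_closed[of v y] J.I_r_closed[of w z] gens by simp_all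
      then show "p \<in> Idl\<^bsub>ring_on S\<^esub> {u, v, w}"
        using J.a_closed[of "u * x + v * y" "w * z"] J.a_closed[of "u * x" "v * y"] p by simp
    qed
  qed
qed

lemma Idl_ring_on_pair:
  assumes R: "cring (ring_on S)" and S: "u \<in> S" "v \<in> S"
  shows "Idl\<^bsub>ring_on S\<^esub> {u, v} = {u * x + v * y | x y. x \<in> S \<and> y \<in> S}"
proof -
  interpret cring "ring_on S" by (rule R)
  have "{u * x + v * y + v * z | x y z. x \<in> S \<and> y \<in> S \<and> z \<in> S} =
      {u * x + v * y | x y. x \<in> S \<and> y \<in> S}" (is "?A = ?B")
  proof
    show "?A \<subseteq> ?B"
    proof
      fix p assume "p \<in> ?A"
      then obtain x y z where "p = u * x + v * y + v * z" "x \<in> S" "y \<in> S" "z \<in> S" by blast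
      then have "p = u * x + v * (y + z)" "y + z \<in> S"
        using a_closed[of y z] by (simp_all add: algebra_simps)
      then show "p \<in> ?B" using \<open>x \<in> S\<close> by blast
    qed
    show "?B \<subseteq> ?A"
    proof
      fix p assume "p \<in> ?B"
      then obtain x y where "p = u * x + v * y + v * 0" "x \<in> S" "y \<in> S" by auto
      then show "p \<in> ?A" using zero_closed by (simp del: mult_zero_right) blast
    qed
  qed
  then show ?thesis using Idl_ring_on_triple[OF R S S(2)] by simp
qed

section \<open>Valuation domains with algebraically closed residue field\<close>

text \<open>Polynomials over a record ring are lists that begin with the leading coefficient, which accounts for
  the reversal.\<close>

lemma eval_ring_on:
  "ring.eval (ring_on S) l a = poly (Poly (rev l)) a" if "ring (ring_on S)"
proof (induction l)
  case Nil
  show ?case by (simp add: ring.eval.simps[OF that])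
next
  case (Cons b l)
  then show ?case
    by (simp add: ring.eval.simps[OF that] Poly_append poly_monom mult.commute add.commute)
qed

text \<open>A split polynomial has as many roots as its degree; a root in the quotient is the class of some \<open>a\<close>.\<close>

lemma root_mod_ideal:
  assumes R: "cring (ring_on V)" and "maximalideal M (ring_on V)"
    and closed: "algebraically_closed (ring_on V Quot M)"
    and p: "coeffs_in V p" "lead_coeff p \<notin> M" "0 < degree p"
  shows "\<exists>a\<in>V. poly p a \<in> M"
proof -
  interpret R: cring "ring_on V" by (rule R)
  interpret M: maximalideal M "ring_on V" by fact
  interpret L: algebraically_closed "ring_on V Quot M" by fact
  let ?h = "\<lambda>x. M +>\<^bsub>ring_on V\<^esub> x"
  interpret h: ring_hom_ring "ring_on V" "ring_on V Quot M" ?h by (rule M.rcos_ring_hom_ring)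
  define l where "l = rev (coeffs p)"
  have "p \<noteq> 0" using p(3) by auto
  have l: "set l \<subseteq> V" "l \<noteq> []" "hd l = lead_coeff p" "length l = Suc (degree p)"
    using p(1) \<open>p \<noteq> 0\<close> unfolding l_def coeffs_in_def
    by (auto simp: coeffs_def hd_rev last_coeffs_eq_coeff_degree length_coeffs_degree)
  have zero_iff: "?h x = \<zero>\<^bsub>ring_on V Quot M\<^esub> \<longleftrightarrow> x \<in> M" if "x \<in> V" for x
    using M.a_rcos_const[of x] M.a_rcos_self[of x] that by (auto simp: FactRing_def)
  have "?h (lead_coeff p) \<noteq> \<zero>\<^bsub>ring_on V Quot M\<^esub>"
    using zero_iff p(1,2) unfolding coeffs_in_def by blast
  then have poly: "map ?h l \<in> carrier (poly_ring (ring_on V Quot M))"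
    using l h.hom_closed by (auto simp: univ_poly_def polynomial_def hd_map)
  have "L.splitted (map ?h l)" by (rule L.roots_over_carrier[OF poly])
  then have "size (L.roots (map ?h l)) = degree p" using l(4) by (simp add: L.splitted_def)
  then obtain b where "b \<in># L.roots (map ?h l)" using p(3) by (metis multiset_nonemptyE nat_less_le size_empty)
  then have b: "b \<in> carrier (ring_on V Quot M)" "L.eval (map ?h l) b = \<zero>\<^bsub>ring_on V Quot M\<^esub>"
    using L.roots_mem_iff_is_root[OF poly] unfolding L.is_root_def by auto
  obtain a where a: "a \<in> V" "b = ?h a"
    using b(1) by (auto simp: FactRing_def A_RCOSETS_def' a_r_coset_def)
  have "?h (R.eval l a) = \<zero>\<^bsub>ring_on V Quot M\<^esub>"
    using b(2) h.eval_hom'[of a l] a l(1) by simp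
  moreover have "R.eval l a = poly p a"
    unfolding l_def by (simp add: eval_ring_on[OF R.ring_axioms])
  moreover have "R.eval l a \<in> V" using R.eval_in_carrier[of l a] l(1) a(1) by simp
  ultimately show ?thesis using zero_iff a(1) by metis
qed

lemma valuation_ring_nonunits:
  assumes "valuation_domain V"
  shows "valuation_ring V {x \<in> V. x = 0 \<or> inverse x \<notin> V}"
proof -
  have sub: "subring V (ring_of_type_algebra)" and total: "\<And>x. x \<noteq> 0 \<Longrightarrow> x \<in> V \<or> inverse x \<in> V"
    using assms unfolding valuation_domain_def by auto
  interpret subring V ring_of_type_algebra by (rule sub)
  interpret A: ring "ring_of_type_algebra :: 'a ring" by (rule ring_from_type_algebra)
  have one: "1 \<in> V" and mult: "\<And>x y. x \<in> V \<Longrightarrow> y \<in> V \<Longrightarrow> x * y \<in> V"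
    and add: "\<And>x y. x \<in> V \<Longrightarrow> y \<in> V \<Longrightarrow> x + y \<in> V"
    using one_closed m_closed subringE(7)[OF sub] by (simp_all add: ring_of_type_algebra_def)
  have "\<ominus>\<^bsub>ring_of_type_algebra\<^esub> (1::'a) = - 1"
    using A.r_neg[of 1] by (simp add: ring_of_type_algebra_def eq_neg_iff_add_eq_0 add.commute)
  then have m1: "- 1 \<in> V" using subringE(5)[OF sub one] by simp
  have diff: "x - y \<in> V" if "x \<in> V" "y \<in> V" for x y
    using add[OF that(1) mult[OF m1 that(2)]] by simp
  have inv: "inverse x \<in> V" if "x \<noteq> 0" "x \<notin> V" for x using total that by blast
  show ?thesis by unfold_locales (use one mult diff inv in auto)
qed

text \<open>The nonunits of a valuation ring form an ideal, so the maximal ideal consists of them. If some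
  \<open>m \<in> M\<close> had \<open>m / s \<notin> M\<close> for all nonzero \<open>s \<in> M\<close>, then all elements of \<open>M\<close> would be multiples of \<open>m\<close>.\<close>

lemma valuation_ring_with_roots_maximalideal:
  assumes V: "valuation_domain V" and M: "maximalideal M (ring_on V)"
    and closed: "algebraically_closed (ring_on V Quot M)" and np: "\<not> principalideal M (ring_on V)"
  shows "valuation_ring_with_roots V M"
proof -
  define N where "N = {x \<in> V. x = 0 \<or> inverse x \<notin> V}"
  interpret N: valuation_ring V N unfolding N_def by (rule valuation_ring_nonunits[OF V])
  have R: "cring (ring_on V)" by (intro cring_ring_on N.one_V N.diff_V N.mult_V)
  interpret R: cring "ring_on V" by (rule R)
  interpret M: maximalideal M "ring_on V" by (rule M)
  have "x \<in> N" if "x \<in> M" for x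
  proof (rule ccontr)
    assume "x \<notin> N"
    have x: "x \<in> V" using M.a_subset that by auto
    have "x * inverse x \<in> M" "x \<noteq> 0"
      using M.I_r_closed[OF that, of "inverse x"] N.unit_inverse_V[OF x \<open>x \<notin> N\<close>]
        \<open>x \<notin> N\<close> N.zero_M by auto
    then have "1 \<in> M" by simp
    then show False using M.one_imp_carrier M.I_notcarr by simp
  qed
  moreover have "ideal N (ring_on V)"
    by (rule ideal_ring_onI[OF R]) (use N.M_subset_V N.zero_M N.add_M N.mult_M in auto)
  ultimately have "N = M \<or> N = V" using M.I_maximal[of N] N.M_subset_V by auto
  then have NM: "N = M" using N.one_V N.one_notin_M by blast
  have "\<exists>s\<in>M. s \<noteq> 0 \<and> m / s \<in> M" if m: "m \<in> M" for m
  proof (rule ccontr)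
    assume none: "\<not> ?thesis"
    have "x \<in> Idl\<^bsub>ring_on V\<^esub> {m}" if x: "x \<in> M" for x
    proof -
      have "x / m \<in> V \<and> (m = 0 \<longrightarrow> x = 0)"
        using none x N.divide_cases[of x m] N.zero_M N.zero_V NM by auto
      then have "(x / m) * m \<in> Idl\<^bsub>ring_on V\<^esub> {m}" and "(x / m) * m = x"
        using ideal.I_l_closed[OF R.genideal_ideal, of "{m}" m "x / m"]
          R.genideal_self'[of m] m N.M_subset_V NM by auto
      then show ?thesis by simp
    qed
    then have "M = Idl\<^bsub>ring_on V\<^esub> {m}"
      using R.genideal_minimal[OF M.ideal_axioms, of "{m}"] m by blast
    then have "principalideal M (ring_on V)"
      using m N.M_subset_V NM by (intro principalidealI[OF M.ideal_axioms] bexI[of _ m]) auto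
    then show False using np by contradiction
  qed
  moreover have "valuation_ring V M" using N.valuation_ring_axioms NM by simp
  ultimately show ?thesis
    using root_mod_ideal[OF R M closed]
    by (auto simp: valuation_ring_with_roots_def valuation_ring_with_roots_axioms_def)
qed

section \<open>Values of rational functions\<close>

lemma rat_definedE:
  assumes "rat_defined_at \<phi> a"
  obtains p q where "\<phi> = Fract p q" "poly q a \<noteq> 0" "q \<noteq> 0" "rat_eval \<phi> a = poly p a / poly q a"
  using assms rat_eval_Fract unfolding rat_defined_at_def by (metis poly_0)

lemma rat_defined_at_Fract: "poly q a \<noteq> 0 \<Longrightarrow> rat_defined_at (Fract p q) a"
  unfolding rat_defined_at_def by blast

lemma rat_eval_diff:
  assumes "rat_defined_at \<phi> a" "rat_defined_at \<psi> a"
  shows "rat_defined_at (\<phi> - \<psi>) a" "rat_eval (\<phi> - \<psi>) a = rat_eval \<phi> a - rat_eval \<psi> a"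
proof -
  obtain p q where p: "\<phi> = Fract p q" "poly q a \<noteq> 0" "q \<noteq> 0" "rat_eval \<phi> a = poly p a / poly q a"
    using assms(1) by (rule rat_definedE)
  obtain r s where r: "\<psi> = Fract r s" "poly s a \<noteq> 0" "s \<noteq> 0" "rat_eval \<psi> a = poly r a / poly s a"
    using assms(2) by (rule rat_definedE)
  have "\<phi> - \<psi> = Fract (p * s - r * q) (q * s)" using p r by simp
  moreover have "poly (q * s) a \<noteq> 0" using p r by simp
  ultimately show "rat_defined_at (\<phi> - \<psi>) a" "rat_eval (\<phi> - \<psi>) a = rat_eval \<phi> a - rat_eval \<psi> a"
    using p r by (auto simp: rat_eval_Fract rat_defined_at_Fract field_simps)
qed

lemma rat_eval_mult:
  assumes "rat_defined_at \<phi> a" "rat_defined_at \<psi> a"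
  shows "rat_defined_at (\<phi> * \<psi>) a" "rat_eval (\<phi> * \<psi>) a = rat_eval \<phi> a * rat_eval \<psi> a"
proof -
  obtain p q where p: "\<phi> = Fract p q" "poly q a \<noteq> 0" "q \<noteq> 0" "rat_eval \<phi> a = poly p a / poly q a"
    using assms(1) by (rule rat_definedE)
  obtain r s where r: "\<psi> = Fract r s" "poly s a \<noteq> 0" "s \<noteq> 0" "rat_eval \<psi> a = poly r a / poly s a"
    using assms(2) by (rule rat_definedE)
  have "\<phi> * \<psi> = Fract (p * r) (q * s)" using p r by simp
  moreover have "poly (q * s) a \<noteq> 0" using p r by simp
  ultimately show "rat_defined_at (\<phi> * \<psi>) a" "rat_eval (\<phi> * \<psi>) a = rat_eval \<phi> a * rat_eval \<psi> a"
    using p r by (auto simp: rat_eval_Fract rat_defined_at_Fract)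
qed

lemma rat_eval_const: "rat_defined_at (rat_const c) a" "rat_eval (rat_const c) a = c"
  unfolding rat_const_def by (simp_all add: rat_eval_Fract rat_defined_at_Fract)

lemma rat_eval_X: "rat_defined_at rat_X a" "rat_eval rat_X a = a"
  unfolding rat_X_def by (simp_all add: rat_eval_Fract rat_defined_at_Fract)

lemma rat_eval_0_1: "rat_defined_at 0 a" "rat_eval 0 a = 0" "rat_defined_at 1 a" "rat_eval 1 a = 1"
  using rat_eval_const[of 0 a] rat_eval_const[of 1 a]
  by (simp_all add: rat_const_def Zero_fract_def One_fract_def one_pCons)

lemma rat_eval_add:
  assumes "rat_defined_at \<phi> a" "rat_defined_at \<psi> a"
  shows "rat_defined_at (\<phi> + \<psi>) a" "rat_eval (\<phi> + \<psi>) a = rat_eval \<phi> a + rat_eval \<psi> a"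
proof -
  note m = rat_eval_diff[OF rat_eval_0_1(1) assms(2)]
  show "rat_defined_at (\<phi> + \<psi>) a" "rat_eval (\<phi> + \<psi>) a = rat_eval \<phi> a + rat_eval \<psi> a"
    using rat_eval_diff[OF assms(1) m(1)] m(2) rat_eval_0_1(2)[of a] by simp_all
qed

lemma Int_R_D:
  assumes "\<phi> \<in> Int_R V" "a \<in> V"
  shows "rat_defined_at \<phi> a" "rat_eval \<phi> a \<in> V"
  using assms unfolding Int_R_def by auto

section \<open>The ideal generated by two squares\<close>

context valuation_ring begin

lemma Int_R_ring: "cring (Int_R_ring V)"
  by (rule cring_ring_on)
    (auto simp: Int_R_def rat_eval_0_1 rat_eval_diff rat_eval_mult intro: one_V diff_V mult_V)

lemma Int_R_generators: "c \<in> V \<Longrightarrow> rat_const c \<in> Int_R V" "rat_X \<in> Int_R V"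
  by (auto simp: Int_R_def rat_eval_const rat_eval_X)

lemma Int_R_mult: "\<phi> \<in> Int_R V \<Longrightarrow> \<psi> \<in> Int_R V \<Longrightarrow> \<phi> * \<psi> \<in> Int_R V"
  using cring.cring_simprules(5)[OF Int_R_ring] by simp

text \<open>One of \<open>a / t\<close> and \<open>t / a\<close> lies in \<open>V\<close>, so \<open>a t\<close> is a multiple of \<open>t\<^sup>2\<close> or of \<open>a\<^sup>2\<close>. The choice depends
  on \<open>a\<close>, so that this representation does not come from one of \<open>x t\<close> in the ring of rational functions.\<close>

lemma square_sum_absorbs_product:
  assumes "a \<in> V" "t \<in> V" "r \<in> V"
  shows "\<exists>x\<in>V. \<exists>y\<in>V. a * t * r = a\<^sup>2 * x + t\<^sup>2 * y"
proof (cases "a = 0 \<or> t = 0")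
  case True
  then show ?thesis using zero_V by (intro bexI[of _ 0]) auto
next
  case False
  show ?thesis
  proof (cases "a / t \<in> V")
    case True
    then have "a / t * r \<in> V" using assms mult_V by blast
    moreover have "a * t * r = a\<^sup>2 * 0 + t\<^sup>2 * (a / t * r)"
      using False by (simp add: power2_eq_square)
    ultimately show ?thesis using zero_V by blast
  next
    case not: False
    then have "t / a * r \<in> V" using assms mult_V divide_total by blast
    moreover have "a * t * r = a\<^sup>2 * (t / a * r) + t\<^sup>2 * 0"
      using False by (simp add: power2_eq_square)
    ultimately show ?thesis using zero_V by blast
  qed
qed

lemma Int_R_generators_square:
  assumes "t \<in> V"
  shows "rat_X\<^sup>2 \<in> Int_R V" "rat_const t ^ 2 \<in> Int_R V" "rat_X * rat_const t \<in> Int_R V"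
  unfolding power2_eq_square by (intro Int_R_mult Int_R_generators assms)+

lemma Idl_squares:
  assumes "t \<in> V"
  shows "Idl\<^bsub>Int_R_ring V\<^esub> {rat_X\<^sup>2, rat_const t ^ 2} =
      {rat_X\<^sup>2 * \<phi> + rat_const t ^ 2 * \<psi> | \<phi> \<psi>. \<phi> \<in> Int_R V \<and> \<psi> \<in> Int_R V}"
  by (rule Idl_ring_on_pair[OF Int_R_ring Int_R_generators_square(1,2)[OF assms]])

lemma rat_eval_squares:
  assumes "\<phi> \<in> Int_R V" "\<psi> \<in> Int_R V" "a \<in> V"
  shows "rat_eval (rat_X\<^sup>2 * \<phi> + rat_const t ^ 2 * \<psi>) a =
    a\<^sup>2 * rat_eval \<phi> a + t\<^sup>2 * rat_eval \<psi> a"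
  using Int_R_D(1)[OF assms(1,3)] Int_R_D(1)[OF assms(2,3)]
  by (simp add: power2_eq_square rat_eval_add rat_eval_mult rat_eval_X rat_eval_const)

lemma value_ideal_squares:
  assumes "t \<in> V" "a \<in> V"
  shows "value_ideal (Idl\<^bsub>Int_R_ring V\<^esub> {rat_X\<^sup>2, rat_const t ^ 2}) a =
    {a\<^sup>2 * x + t\<^sup>2 * y | x y. x \<in> V \<and> y \<in> V}" (is "?A = ?B")
proof
  show "?A \<subseteq> ?B"
  proof
    fix z assume "z \<in> ?A"
    then obtain \<phi> \<psi> where "\<phi> \<in> Int_R V" "\<psi> \<in> Int_R V"
      "z = rat_eval (rat_X\<^sup>2 * \<phi> + rat_const t ^ 2 * \<psi>) a"
      unfolding value_ideal_def Idl_squares[OF assms(1)] by auto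
    then have "z = a\<^sup>2 * rat_eval \<phi> a + t\<^sup>2 * rat_eval \<psi> a" "rat_eval \<phi> a \<in> V" "rat_eval \<psi> a \<in> V"
      using rat_eval_squares[OF _ _ assms(2)] Int_R_D(2)[OF _ assms(2)] by auto
    then show "z \<in> ?B" by blast
  qed
  show "?B \<subseteq> ?A"
  proof
    fix z assume "z \<in> ?B"
    then obtain x y where z: "x \<in> V" "y \<in> V" "z = a\<^sup>2 * x + t\<^sup>2 * y" by blast
    then have "z = rat_eval (rat_X\<^sup>2 * rat_const x + rat_const t ^ 2 * rat_const y) a"
      using rat_eval_squares[OF Int_R_generators(1) Int_R_generators(1) assms(2)]
      by (simp add: rat_eval_const)
    then show "z \<in> ?A"
      using z Int_R_generators(1) unfolding value_ideal_def Idl_squares[OF assms(1)] by blast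
  qed
qed

lemma product_in_skolem_closure:
  assumes "t \<in> V"
  shows "rat_X * rat_const t \<in>
    skolem_closure V (Idl\<^bsub>Int_R_ring V\<^esub> {rat_X\<^sup>2, rat_const t ^ 2})"
proof -
  have "rat_eval (rat_X * rat_const t) a = a * t * 1" for a
    by (simp add: rat_eval_mult rat_eval_X rat_eval_const)
  then have "rat_eval (rat_X * rat_const t) a \<in>
      value_ideal (Idl\<^bsub>Int_R_ring V\<^esub> {rat_X\<^sup>2, rat_const t ^ 2}) a" if "a \<in> V" for a
    unfolding value_ideal_squares[OF assms that]
    using square_sum_absorbs_product[OF that assms one_V] by auto
  then show ?thesis
    unfolding skolem_closure_def using Int_R_generators_square(3)[OF assms] by blast
qed

lemma value_ideal_adjoin_product:
  assumes "t \<in> V" "a \<in> V"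
  shows "value_ideal (Idl\<^bsub>Int_R_ring V\<^esub> {rat_X\<^sup>2, rat_const t ^ 2, rat_X * rat_const t}) a =
    value_ideal (Idl\<^bsub>Int_R_ring V\<^esub> {rat_X\<^sup>2, rat_const t ^ 2}) a" (is "value_ideal ?J a = value_ideal ?I a")
proof
  note mem = Int_R_generators_square[OF assms(1)]
  note J = Idl_ring_on_triple[OF Int_R_ring mem]
  show "value_ideal ?J a \<subseteq> value_ideal ?I a"
  proof
    fix z assume "z \<in> value_ideal ?J a"
    then obtain \<phi> \<psi> \<chi> where *: "\<phi> \<in> Int_R V" "\<psi> \<in> Int_R V" "\<chi> \<in> Int_R V"
      "z = rat_eval (rat_X\<^sup>2 * \<phi> + rat_const t ^ 2 * \<psi> + rat_X * rat_const t * \<chi>) a"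
      unfolding value_ideal_def J by blast
    note d = *(1-3)[THEN Int_R_D(1), OF assms(2)] and v = *(1-3)[THEN Int_R_D(2), OF assms(2)]
    have z: "z = a\<^sup>2 * rat_eval \<phi> a + t\<^sup>2 * rat_eval \<psi> a + a * t * rat_eval \<chi> a"
      using *(4) d
      by (simp add: power2_eq_square rat_eval_add rat_eval_mult rat_eval_X rat_eval_const)
    obtain x y where "x \<in> V" "y \<in> V" "a * t * rat_eval \<chi> a = a\<^sup>2 * x + t\<^sup>2 * y"
      using square_sum_absorbs_product[OF assms(2,1) v(3)] by blast
    then have "z = a\<^sup>2 * (rat_eval \<phi> a + x) + t\<^sup>2 * (rat_eval \<psi> a + y)"
      "rat_eval \<phi> a + x \<in> V" "rat_eval \<psi> a + y \<in> V"
      using z v add_V by (auto simp: algebra_simps)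
    then show "z \<in> value_ideal ?I a" unfolding value_ideal_squares[OF assms] by blast
  qed
  interpret cring "Int_R_ring V" by (rule Int_R_ring)
  have "?I \<subseteq> ?J"
    by (rule genideal_minimal[OF genideal_ideal]) (use mem genideal_self[of "{rat_X\<^sup>2, rat_const t ^ 2, rat_X * rat_const t}"] in auto)
  then show "value_ideal ?I a \<subseteq> value_ideal ?J a" unfolding value_ideal_def by blast
qed

end

text \<open>The substitution \<open>x = t y\<close> turns \<open>x t = x\<^sup>2 \<phi> + t\<^sup>2 \<psi>\<close> into \<open>y = y\<^sup>2 f + g\<close>, where the values of \<open>f\<close> and \<open>g\<close>
  are integral also at points \<open>y\<close> of negative value, as long as \<open>t y \<in> V\<close>.\<close>

lemma (in valuation_ring_with_roots) product_notin_Idl_squares: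
  assumes "t \<in> M" "t \<noteq> 0"
  shows "rat_X * rat_const t \<notin> Idl\<^bsub>Int_R_ring V\<^esub> {rat_X\<^sup>2, rat_const t ^ 2}"
proof
  note tV = M_subset_V[OF assms(1)]
  assume "rat_X * rat_const t \<in> Idl\<^bsub>Int_R_ring V\<^esub> {rat_X\<^sup>2, rat_const t ^ 2}"
  then obtain \<phi> \<psi> where *: "\<phi> \<in> Int_R V" "\<psi> \<in> Int_R V"
    "rat_X * rat_const t = rat_X\<^sup>2 * \<phi> + rat_const t ^ 2 * \<psi>"
    unfolding Idl_squares[OF tV] by blast
  obtain p q where q: "\<phi> = Fract p q" "q \<noteq> 0" by (cases \<phi>) auto
  have eq: "a * t = a\<^sup>2 * rat_eval \<phi> a + t\<^sup>2 * rat_eval \<psi> a" if "a \<in> V" for a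
    using arg_cong[OF *(3), of "\<lambda>\<theta>. rat_eval \<theta> a"] rat_eval_squares[OF *(1,2) that]
    by (simp add: rat_eval_mult rat_eval_X rat_eval_const)
  \<comment> \<open>The given fraction need not be the one that is defined at \<open>a\<close>; the product form holds for all of them.\<close>
  have val: "poly p a = rat_eval \<phi> a * poly q a" if aV: "a \<in> V" for a
  proof -
    obtain r s where r: "\<phi> = Fract r s" "poly s a \<noteq> 0" "s \<noteq> 0" "rat_eval \<phi> a = poly r a / poly s a"
      using Int_R_D(1)[OF *(1) aV] by (rule rat_definedE)
    then have "p * s = r * q" using q by (simp add: eq_fract)
    then have "poly p a * poly s a = poly r a * poly q a" by (metis poly_mult)
    then have "poly p a * poly s a = rat_eval \<phi> a * poly q a * poly s a" using r(2,4) by simp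
    then show ?thesis using r(2) by simp
  qed
  have "pcompose q [:0, t:] \<noteq> 0" using q(2) assms(2) by (simp add: pcompose_eq_0_iff)
  then show False
  proof (rule no_integral_solution[OF assms, where P = "pcompose p [:0, t:]"
        and f = "\<lambda>y. rat_eval \<phi> (t * y)" and g = "\<lambda>y. rat_eval \<psi> (t * y)"])
    fix y assume y: "t * y \<in> V"
    show "rat_eval \<phi> (t * y) \<in> V" "rat_eval \<psi> (t * y) \<in> V"
      using Int_R_D(2) *(1,2) y by blast+
    show "poly (pcompose p [:0, t:]) y = rat_eval \<phi> (t * y) * poly (pcompose q [:0, t:]) y"
      using val[OF y] by (simp add: poly_pcompose mult.commute)
    have "t\<^sup>2 * y = t\<^sup>2 * (y\<^sup>2 * rat_eval \<phi> (t * y) + rat_eval \<psi> (t * y))"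
      using eq[OF y] by (simp add: power2_eq_square algebra_simps)
    then show "y = y\<^sup>2 * rat_eval \<phi> (t * y) + rat_eval \<psi> (t * y)" using assms(2) by simp
  qed
qed

section \<open>Failure of the strong Skolem property\<close>

theorem proposition5p11:
  fixes V M :: "'k::field set"
  assumes "valuation_domain V"
    and "maximalideal M (ring_on V)"
    and "algebraically_closed (ring_on V Quot M)"
    and "\<not> principalideal M (ring_on V)"
    and "\<not> divisible_group (value_group V)"
  shows "(\<forall>t\<in>M. t \<noteq> 0 \<longrightarrow>
            fin_gen_ideal (Idl\<^bsub>Int_R_ring V\<^esub> {rat_X ^ 2, rat_const t ^ 2}) (Int_R_ring V) \<and>
            \<not> skolem_closed V (Idl\<^bsub>Int_R_ring V\<^esub> {rat_X ^ 2, rat_const t ^ 2}))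
         \<and> \<not> strong_skolem_property V"
proof -
  interpret valuation_ring_with_roots V M
    by (rule valuation_ring_with_roots_maximalideal[OF assms(1-4)])
  interpret R: cring "Int_R_ring V" by (rule Int_R_ring)
  let ?I = "\<lambda>t. Idl\<^bsub>Int_R_ring V\<^esub> {rat_X ^ 2, rat_const t ^ 2}"
  let ?J = "\<lambda>t. Idl\<^bsub>Int_R_ring V\<^esub> {rat_X ^ 2, rat_const t ^ 2, rat_X * rat_const t}"
  have mem: "{rat_X ^ 2, rat_const t ^ 2, rat_X * rat_const t} \<subseteq> carrier (Int_R_ring V)"
    if "t \<in> M" for t
    using Int_R_generators_square[OF M_subset_V[OF that]] by simp
  have fin: "fin_gen_ideal (?I t) (Int_R_ring V)" "fin_gen_ideal (?J t) (Int_R_ring V)"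
    if "t \<in> M" for t
    unfolding fin_gen_ideal_def using mem[OF that]
    by (intro exI[of _ "{rat_X ^ 2, rat_const t ^ 2}"],
        auto intro!: exI[of _ "{rat_X ^ 2, rat_const t ^ 2, rat_X * rat_const t}"])
  have "\<not> skolem_closed V (?I t)" if "t \<in> M" "t \<noteq> 0" for t
    using product_in_skolem_closure[OF M_subset_V] product_notin_Idl_squares that
    unfolding skolem_closed_def by blast
  moreover have "\<not> strong_skolem_property V"
  proof
    assume "strong_skolem_property V"
    obtain t where t: "t \<in> M" "t \<noteq> 0" using factor_in_M[OF zero_M] by blast
    have "?J t = ?I t"
      using \<open>strong_skolem_property V\<close> fin[OF t(1)] value_ideal_adjoin_product[OF M_subset_V[OF t(1)]]
      unfolding strong_skolem_property_def by blast
    moreover have "rat_X * rat_const t \<in> ?J t" using R.genideal_self[OF mem[OF t(1)]] by blast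
    ultimately show False using product_notin_Idl_squares[OF t] by simp
  qed
  ultimately show ?thesis using fin by blast
qed

end
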